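(* Let $X$ be a set with $|X|\geqslant4$ and let $\mathbf G_1,\mathbf G_2$ be $3$-ary convexities on $X$ that are conically independent. Then $\mathbf G_1$ and $\mathbf G_2$ are (mutually $(3)$-)independent; that is, $A=\mathbf g_1A\cap\mathbf g_2A$ for every $A\in(3)\text{-}\frac{1}{\{\mathbf G_1,\mathbf G_2\}}$.
   Context: A convexity on $X$ is a family $\mathbf G\subset 2^X$ such that $X\in\mathbf G$ and $\mathbf G$ is closed under arbitrary intersections of its elements. Its convex hull operator $\mathbf g$ sends $A\subset X$ to the intersection of all members of $\mathbf G$ containing $A$. The convexity $\mathbf G$ is finitely defined if $\mathbf gA=\bigcup\{\mathbf gB:B\subset A,\ |B|<\infty\}$ for every $A\subset X$. It is $n$-ary if for every $A\subset X$: $A\in\mathbf G$ if and only if $\mathbf gB\subset A$ for all $B\subset A$ with $|B|\leqslant n$. (Every $n$-ary convexity is finitely defined.) Let $\mathbf g_1,\mathbf g_2$ be the hull operators of $\mathbf G_1,\mathbf G_2$, and put $\mathbf g^{\cap}A=\mathbf g_1A\cap\mathbf g_2A$ for $A\subset X$. Two finitely defined convexities $\mathbf G_1$ and $\mathbf G_2$ on $X$, $|X|\geqslant4$, are conically independent if for every natural number $n\geqslant4$, every $B\subset X$ with $|B|=n-1$, every $x_n\in X\setminus B$ and every $x\in\mathbf g^{\cap}(B\cup\{x_n\})$ there exist $y_1,y_2\in\mathbf g^{\cap}B$ such that $x\in\mathbf g_1\{y_1,x_n\}\cap\mathbf g_2\{y_2,x_n\}$. The family $(n)\text{-}\frac{1}{\{\mathbf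 G_1,\mathbf G_2\}}$ consists of all $A\subset X$ such that for every $B\subset A$ with $|B|\leqslant n$ there exists $i\in\{1,2\}$ with $\mathbf g_iB\subset A$. Two $n$-ary convexities $\mathbf G_1,\mathbf G_2$ are mutually $(n)$-independent (briefly, independent) if $A=\mathbf g_1A\cap\mathbf g_2A$ for every $A\in(n)\text{-}\frac{1}{\{\mathbf G_1,\mathbf G_2\}}$. *)

theory Defs
  imports Complex_Main
begin

text \<open>
  Convexities live on an explicit ground set \<open>X\<close>. Closure under intersection is required for
  nonempty families only: the empty intersection is \<open>X\<close>, which is a member anyway.
  The empty set is not required to be a member.
\<close>

definition convexity_on :: "'a set \<Rightarrow> 'a set set \<Rightarrow> bool" where
  "convexity_on X G \<longleftrightarrow>
     G \<subseteq> Pow X \<and> X \<in> G \<and> (\<forall>F. F \<subseteq> G \<and> F \<noteq> {} \<longrightarrow> \<Inter>F \<in> G)"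

text \<open>
  For \<open>A \<subseteq> X\<close> the intersected family contains \<open>X\<close>, so the hull is a subset of \<open>X\<close>.
\<close>

definition hull_of :: "'a set set \<Rightarrow> 'a set \<Rightarrow> 'a set" where
  "hull_of G A = (\<lambda>C. C \<in> G) hull A"

definition nary_convexity_on :: "nat \<Rightarrow> 'a set \<Rightarrow> 'a set set \<Rightarrow> bool" where
  "nary_convexity_on n X G \<longleftrightarrow> convexity_on X G \<and>
     (\<forall>A\<subseteq>X. A \<in> G \<longleftrightarrow> (\<forall>B\<subseteq>A. finite B \<and> card B \<le> n \<longrightarrow> hull_of G B \<subseteq> A))"

definition hull_cap :: "'a set set \<Rightarrow> 'a set set \<Rightarrow> 'a set \<Rightarrow> 'a set" where
  "hull_cap G1 G2 A = hull_of G1 A \<inter> hull_of G2 A"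

text \<open>
  Conical independence is intended for finitely defined convexities on a set with at least
  four elements, and mutual independence for \<open>n\<close>-ary convexities. These preconditions are
  left to the context and are not conjuncts of the predicates.
\<close>

definition conically_independent :: "'a set \<Rightarrow> 'a set set \<Rightarrow> 'a set set \<Rightarrow> bool" where
  "conically_independent X G1 G2 \<longleftrightarrow>
     (\<forall>n\<ge>4. \<forall>B\<subseteq>X. finite B \<and> card B = n - 1 \<longrightarrow>
       (\<forall>z\<in>X - B. \<forall>x\<in>hull_cap G1 G2 (B \<union> {z}).
          \<exists>y1\<in>hull_cap G1 G2 B. \<exists>y2\<in>hull_cap G1 G2 B.
            x \<in> hull_of G1 {y1, z} \<inter> hull_of G2 {y2, z}))"

definition reciprocal_family :: "nat \<Rightarrow> 'a set \<Rightarrow> 'a set set \<Rightarrow> 'a set set \<Rightarrow> 'a set set" where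
  "reciprocal_family n X G1 G2 =
     {A. A \<subseteq> X \<and> (\<forall>B\<subseteq>A. finite B \<and> card B \<le> n \<longrightarrow> (\<exists>G\<in>{G1, G2}. hull_of G B \<subseteq> A))}"

definition mutually_independent :: "nat \<Rightarrow> 'a set \<Rightarrow> 'a set set \<Rightarrow> 'a set set \<Rightarrow> bool" where
  "mutually_independent n X G1 G2 \<longleftrightarrow>
     (\<forall>A\<in>reciprocal_family n X G1 G2. A = hull_of G1 A \<inter> hull_of G2 A)"

end

theory Submission
  imports Defs
begin

text \<open>
  Let \<open>A\<close> belong to the reciprocal family. An \<open>n\<close>-ary convexity is finitely defined
  (\<open>hull_of_finite_support\<close>), so a point of \<open>hull_of G1 A \<inter> hull_of G2 A\<close> already lies in
  \<open>hull_cap G1 G2 B\<close> for some finite \<open>B \<subseteq> A\<close>. It is therefore enough to see that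
  \<open>hull_cap G1 G2 B \<subseteq> A\<close> for all finite \<open>B \<subseteq> A\<close>, which goes by induction on the size of \<open>B\<close>
  (\<open>hull_cap_finite_subset\<close>).

  If \<open>B\<close> has at most three points, one of its two hulls is contained in \<open>A\<close>, hence so is
  their intersection. If \<open>B\<close> has at least four points, remove a point \<open>z\<close>. For
  \<open>x \<in> hull_cap G1 G2 B\<close>, conical independence yields \<open>y1, y2 \<in> hull_cap G1 G2 (B - {z})\<close>
  such that \<open>x\<close> is in the first hull of \<open>{y1, z}\<close> and in the second hull of \<open>{y2, z}\<close>.
  By induction \<open>y1\<close> and \<open>y2\<close> lie in \<open>A\<close>, and \<open>x\<close> is in both hulls of \<open>{y1, y2, z}\<close>. This
  set has at most three points, so the first case applies to it.
\<close>

lemma hull_of_mono: "A \<subseteq> B \<Longrightarrow> hull_of G A \<subseteq> hull_of G B"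
  unfolding hull_of_def by (rule hull_mono)

lemma hull_of_superset: "A \<subseteq> hull_of G A"
  unfolding hull_of_def by (rule hull_subset)

lemma hull_of_minimal: "A \<subseteq> C \<Longrightarrow> C \<in> G \<Longrightarrow> hull_of G A \<subseteq> C"
  unfolding hull_of_def by (rule hull_minimal)

lemma hull_of_mem:
  assumes "convexity_on X G" and "A \<subseteq> X"
  shows "hull_of G A \<in> G"
proof -
  have "{C. C \<in> G \<and> A \<subseteq> C} \<subseteq> G" and "{C. C \<in> G \<and> A \<subseteq> C} \<noteq> {}"
    using assms unfolding convexity_on_def by auto
  then show ?thesis
    using assms(1) unfolding convexity_on_def hull_of_def hull_def by blast
qed

text \<open>
  The union of the hulls of the finite subsets of \<open>A\<close> is itself convex: these hulls form an
  upward directed family, so a finite subset of the union lies in a single one of them, and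
  being \<open>n\<close>-ary means that convexity can be tested on finite subsets.
\<close>

lemma hull_of_finite_support:
  assumes nary: "nary_convexity_on n X G" and "A \<subseteq> X" and "x \<in> hull_of G A"
  obtains B where "finite B" "B \<subseteq> A" "x \<in> hull_of G B"
proof -
  have conv: "convexity_on X G"
    and test: "\<And>U. U \<subseteq> X \<Longrightarrow>
      \<forall>C\<subseteq>U. finite C \<and> card C \<le> n \<longrightarrow> hull_of G C \<subseteq> U \<Longrightarrow> U \<in> G"
    using nary unfolding nary_convexity_on_def by auto
  define U where "U = (\<Union>B\<in>{B. finite B \<and> B \<subseteq> A}. hull_of G B)"
  have "X \<in> G" using conv unfolding convexity_on_def by blast
  then have "U \<subseteq> X"
    unfolding U_def using hull_of_minimal[of _ X G] \<open>A \<subseteq> X\<close> by blast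
  have "hull_of G C \<subseteq> U" if "C \<subseteq> U" "finite C" for C
  proof -
    have "\<forall>c\<in>C. \<exists>B. finite B \<and> B \<subseteq> A \<and> c \<in> hull_of G B"
      using \<open>C \<subseteq> U\<close> unfolding U_def by blast
    then obtain f where f: "\<forall>c\<in>C. finite (f c) \<and> f c \<subseteq> A \<and> c \<in> hull_of G (f c)"
      by metis
    define D where "D = (\<Union>c\<in>C. f c)"
    have D: "finite D" "D \<subseteq> A"
      using f \<open>finite C\<close> unfolding D_def by auto
    have "hull_of G (f c) \<subseteq> hull_of G D" if "c \<in> C" for c
      using that unfolding D_def by (intro hull_of_mono) blast
    then have "C \<subseteq> hull_of G D" using f by blast
    moreover have "hull_of G D \<in> G"
      using D \<open>A \<subseteq> X\<close> by (intro hull_of_mem[OF conv]) blast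
    ultimately have "hull_of G C \<subseteq> hull_of G D" by (rule hull_of_minimal)
    then show ?thesis unfolding U_def using D by blast
  qed
  then have "U \<in> G" using test[OF \<open>U \<subseteq> X\<close>] by blast
  moreover have "A \<subseteq> U"
  proof
    fix a assume "a \<in> A"
    then show "a \<in> U"
      unfolding U_def using hull_of_superset[of "{a}" G] by (intro UN_I[of "{a}"]) auto
  qed
  ultimately have "x \<in> U" using hull_of_minimal[of A U G] \<open>x \<in> hull_of G A\<close> by blast
  then obtain B where "finite B" "B \<subseteq> A" "x \<in> hull_of G B" unfolding U_def by blast
  then show thesis by (rule that)
qed

lemma hull_cap_small_subset:
  assumes "A \<in> reciprocal_family n X G1 G2" and "B \<subseteq> A" "finite B" "card B \<le> n"
  shows "hull_cap G1 G2 B \<subseteq> A"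
proof -
  have "\<exists>G\<in>{G1, G2}. hull_of G B \<subseteq> A"
    using assms unfolding reciprocal_family_def by simp
  then show ?thesis unfolding hull_cap_def by blast
qed

text \<open>
  Conical independence reduces a set of at least four points to the three points
  \<open>y1\<close>, \<open>y2\<close>, \<open>z\<close>; this is where the bound \<open>3\<close> on the size of test sets comes from.
\<close>

lemma hull_cap_finite_subset:
  assumes cone: "conically_independent X G1 G2"
    and A: "A \<in> reciprocal_family 3 X G1 G2"
    and "finite B" "B \<subseteq> A"
  shows "hull_cap G1 G2 B \<subseteq> A"
  using \<open>finite B\<close> \<open>B \<subseteq> A\<close>
proof (induction "card B" arbitrary: B rule: less_induct)
  case less
  show ?case
  proof (cases "card B \<le> 3")
    case True
    then show ?thesis using hull_cap_small_subset[OF A less.prems(2,1)] by simp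
  next
    case False
    then obtain z where z: "z \<in> B" by (cases "B = {}") auto
    define B' where "B' = B - {z}"
    have B': "finite B'" "B' \<subseteq> A" "B' \<union> {z} = B" "card B' = card B - 1"
      using z less.prems unfolding B'_def by auto
    have "A \<subseteq> X" using A unfolding reciprocal_family_def by blast
    then have "B' \<subseteq> X" "z \<in> X - B'"
      using z less.prems(2) unfolding B'_def by auto
    have "card B' < card B" using B'(4) False by simp
    then have IH: "hull_cap G1 G2 B' \<subseteq> A"
      using less.hyps[of B'] B' by blast
    show ?thesis
    proof
      fix x assume "x \<in> hull_cap G1 G2 B"
      then have "x \<in> hull_cap G1 G2 (B' \<union> {z})" using B'(3) by simp
      moreover have "card B \<ge> 4" using False by simp
      ultimately have "\<exists>y1\<in>hull_cap G1 G2 B'. \<exists>y2\<in>hull_cap G1 G2 B'.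
          x \<in> hull_of G1 {y1, z} \<inter> hull_of G2 {y2, z}"
        using cone[unfolded conically_independent_def, rule_format, of "card B" B' z x]
          \<open>B' \<subseteq> X\<close> \<open>z \<in> X - B'\<close> B'(1,4) by simp
      then obtain y1 y2
        where y: "y1 \<in> hull_cap G1 G2 B'" "y2 \<in> hull_cap G1 G2 B'"
          and x: "x \<in> hull_of G1 {y1, z}" "x \<in> hull_of G2 {y2, z}"
        by blast
      have "x \<in> hull_cap G1 G2 {y1, y2, z}"
        using x hull_of_mono[of "{y1, z}" "{y1, y2, z}" G1]
          hull_of_mono[of "{y2, z}" "{y1, y2, z}" G2]
        unfolding hull_cap_def by blast
      moreover have "{y1, y2, z} \<subseteq> A" using y IH z less.prems(2) by blast
      moreover have "card {y1, y2, z} \<le> 3" by (simp add: card_insert_if)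
      ultimately show "x \<in> A"
        using hull_cap_small_subset[OF A, of "{y1, y2, z}"] by blast
    qed
  qed
qed

theorem proposition3:
  fixes X :: "'a set" and G1 G2 :: "'a set set"
  assumes "infinite X \<or> card X \<ge> 4"
    and "nary_convexity_on 3 X G1"
    and "nary_convexity_on 3 X G2"
    and "conically_independent X G1 G2"
  shows "mutually_independent 3 X G1 G2"
  unfolding mutually_independent_def
proof (intro ballI equalityI)
  fix A assume A: "A \<in> reciprocal_family 3 X G1 G2"
  then have "A \<subseteq> X" unfolding reciprocal_family_def by blast
  show "A \<subseteq> hull_of G1 A \<inter> hull_of G2 A" by (intro Int_greatest hull_of_superset)
  show "hull_of G1 A \<inter> hull_of G2 A \<subseteq> A"
  proof
    fix x assume x: "x \<in> hull_of G1 A \<inter> hull_of G2 A"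
    obtain B1 where B1: "finite B1" "B1 \<subseteq> A" "x \<in> hull_of G1 B1"
      using hull_of_finite_support[OF assms(2) \<open>A \<subseteq> X\<close>] x by blast
    obtain B2 where B2: "finite B2" "B2 \<subseteq> A" "x \<in> hull_of G2 B2"
      using hull_of_finite_support[OF assms(3) \<open>A \<subseteq> X\<close>] x by blast
    have "x \<in> hull_cap G1 G2 (B1 \<union> B2)"
      using B1(3) B2(3) hull_of_mono[of B1 "B1 \<union> B2" G1] hull_of_mono[of B2 "B1 \<union> B2" G2]
      unfolding hull_cap_def by blast
    then show "x \<in> A"
      using hull_cap_finite_subset[OF assms(4) A, of "B1 \<union> B2"] B1 B2 by blast
  qed
qed

end
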